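(* For every constant $\epsilon\in[0,1)$ there is a constant $C_\epsilon$ such that for every Boolean function $f\colon\{0,1\}^n\to\{0,1\}$, \[ D(f)\le C_\epsilon\,\mathrm{ndeg}_\epsilon(f)^2\,\mathrm{ndeg}(\neg f)^2\quad\text{and}\quad D(f)\le C_\epsilon\,\mathrm{ndeg}(f)^2\,\mathrm{ndeg}_\epsilon(\neg f)^2 . \]
   Context: For $\epsilon\in[0,1)$, $\mathrm{ndeg}_\epsilon(f)$ is the minimum degree of a real polynomial $p$ such that for all $x\in\{0,1\}^n$: $|p(x)|\le\epsilon$ if $f(x)=0$ and $|p(x)|\ge1$ if $f(x)=1$. $\mathrm{ndeg}(f)=\mathrm{ndeg}_0(f)$, i.e. the minimum degree of a multilinear real polynomial $p$ with $p(x)\neq0$ iff $f(x)=1$. $\neg f=1-f$. $D(f)$ is the minimum depth of a deterministic decision tree that queries bits of $x$ and outputs $f(x)$ exactly for every $x\in\{0,1\}^n$. *)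

theory Defs
  imports Complex_Main "HOL-Library.Poly_Mapping"
begin

text \<open>
  The dimension \<open>n\<close> varies under the quantifiers, so a point of the cube is a
  Boolean list of length \<open>n\<close>, and a Boolean function of \<open>n\<close> bits is a function on
  \<open>bool list\<close> of which only the restriction to lists of length \<open>n\<close> is ever used.
\<close>

definition cube :: "nat \<Rightarrow> bool list set" where
  "cube n = {x. length x = n}"

text \<open>
  A real polynomial in variables indexed by \<open>nat\<close>: a finitely supported family of
  coefficients indexed by monomials, a monomial being a finitely supported family
  of exponents. The zero polynomial has degree \<open>0\<close>.
\<close>

type_synonym rpoly = "(nat \<Rightarrow>\<^sub>0 nat) \<Rightarrow>\<^sub>0 real"

definition poly_vars :: "rpoly \<Rightarrow> nat set" where
  "poly_vars p = (\<Union>m\<in>Poly_Mapping.keys p. Poly_Mapping.keys m)"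

definition monom_deg :: "(nat \<Rightarrow>\<^sub>0 nat) \<Rightarrow> nat" where
  "monom_deg m = (\<Sum>i\<in>Poly_Mapping.keys m. Poly_Mapping.lookup m i)"

definition total_deg :: "rpoly \<Rightarrow> nat" where
  "total_deg p = Max (insert 0 (monom_deg ` Poly_Mapping.keys p))"

definition poly_eval :: "rpoly \<Rightarrow> (nat \<Rightarrow> real) \<Rightarrow> real" where
  "poly_eval p v = (\<Sum>m\<in>Poly_Mapping.keys p. Poly_Mapping.lookup p m * (\<Prod>i\<in>Poly_Mapping.keys m. v i ^ Poly_Mapping.lookup m i))"

definition cube_eval :: "rpoly \<Rightarrow> bool list \<Rightarrow> real" where
  "cube_eval p x = poly_eval p (\<lambda>i. of_bool (x ! i))"

definition ndeg_witness :: "nat \<Rightarrow> real \<Rightarrow> (bool list \<Rightarrow> bool) \<Rightarrow> rpoly \<Rightarrow> bool" where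
  "ndeg_witness n \<epsilon> f p \<longleftrightarrow> poly_vars p \<subseteq> {..<n} \<and>
     (\<forall>x\<in>cube n. (\<not> f x \<longrightarrow> \<bar>cube_eval p x\<bar> \<le> \<epsilon>) \<and> (f x \<longrightarrow> \<bar>cube_eval p x\<bar> \<ge> 1))"

definition ndeg_eps :: "nat \<Rightarrow> real \<Rightarrow> (bool list \<Rightarrow> bool) \<Rightarrow> nat" where
  "ndeg_eps n \<epsilon> f = (LEAST d. \<exists>p. ndeg_witness n \<epsilon> f p \<and> total_deg p = d)"

definition ndeg :: "nat \<Rightarrow> (bool list \<Rightarrow> bool) \<Rightarrow> nat" where
  "ndeg n f = ndeg_eps n 0 f"

definition bneg :: "(bool list \<Rightarrow> bool) \<Rightarrow> bool list \<Rightarrow> bool" where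
  "bneg f = (\<lambda>x. \<not> f x)"

text \<open>\<open>Query i t0 t1\<close> queries bit \<open>i\<close> and continues with \<open>t0\<close> if it is \<open>0\<close>, with \<open>t1\<close> if it is \<open>1\<close>.\<close>

datatype dtree = Leaf bool | Query nat dtree dtree

primrec dt_eval :: "dtree \<Rightarrow> bool list \<Rightarrow> bool" where
  "dt_eval (Leaf b) x = b"
| "dt_eval (Query i t0 t1) x = (if x ! i then dt_eval t1 x else dt_eval t0 x)"

primrec dt_depth :: "dtree \<Rightarrow> nat" where
  "dt_depth (Leaf b) = 0"
| "dt_depth (Query i t0 t1) = Suc (max (dt_depth t0) (dt_depth t1))"

primrec dt_queries :: "dtree \<Rightarrow> nat set" where
  "dt_queries (Leaf b) = {}"
| "dt_queries (Query i t0 t1) = insert i (dt_queries t0 \<union> dt_queries t1)"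

definition dt_computes :: "nat \<Rightarrow> dtree \<Rightarrow> (bool list \<Rightarrow> bool) \<Rightarrow> bool" where
  "dt_computes n t f \<longleftrightarrow> dt_queries t \<subseteq> {..<n} \<and> (\<forall>x\<in>cube n. dt_eval t x = f x)"

definition det_query :: "nat \<Rightarrow> (bool list \<Rightarrow> bool) \<Rightarrow> nat" where
  "det_query n f = (LEAST d. \<exists>t. dt_computes n t f \<and> dt_depth t = d)"

end

theory Submission
  imports Defs "HOL-Computational_Algebra.Polynomial"
begin

text \<open>
  Let \<open>q\<close> be a nondeterministic polynomial of degree \<open>e\<close> for \<open>\<not> f\<close> and \<open>p\<close> an \<open>\<epsilon>\<close>-approximate one
  of degree \<open>d\<close> for \<open>f\<close>. Among the points with \<open>f z = 1\<close> choose one that maximises \<open>\<bar>p z\<bar>\<close>; then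
  \<open>\<bar>p\<bar> \<le> \<bar>p z\<bar>\<close> on the whole cube. However the variables outside a top-degree monomial of \<open>q\<close> are
  fixed, \<open>q\<close> does not vanish identically in the remaining ones, so every such monomial contains a
  block of variables whose flip turns \<open>f z\<close> into \<open>0\<close>.

  Given \<open>k\<close> disjoint such blocks, flip each of them independently with probability \<open>t\<close>. The
  expectation of \<open>p / p z\<close> is a polynomial of degree at most \<open>d\<close> in \<open>t\<close>, bounded by \<open>1\<close> on \<open>[0, 1]\<close>,
  whose derivative at \<open>0\<close> is at most \<open>- k * (1 - \<epsilon>)\<close>. Interpolation at the nodes \<open>j\<^sup>2 / d\<^sup>2\<close> bounds
  this derivative by \<open>8 * d\<^sup>2\<close>, hence \<open>k \<le> 8 * d\<^sup>2 / (1 - \<epsilon>)\<close>.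

  Querying all variables of a maximal disjoint family of top-degree monomials of \<open>q\<close> costs at most
  \<open>e * k\<close> queries and lowers the degree of \<open>q\<close>. After \<open>e\<close> rounds \<open>q\<close>, and with it \<open>f\<close>, is constant.
\<close>

subsection \<open>A Markov inequality at an endpoint\<close>

lemma sum_inverse_squares_le: "(\<Sum>j=1..d. 1 / (real j)\<^sup>2) \<le> 2"
proof -
  \<comment> \<open>The sharper bound telescopes, as each new term is at most a difference of
    consecutive reciprocals. Indexing by \<open>Suc d\<close> keeps the reciprocal away from
    0.\<close>
  have *: "(\<Sum>j=1..Suc d. 1 / (real j)\<^sup>2) \<le> 2 - 1 / real (Suc d)" for d
  proof (induction d)
    case (Suc d)
    have "1 / (real (Suc (Suc d)))\<^sup>2 \<le> 1 / real (Suc d) - 1 / real (Suc (Suc d))"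
    proof -
      have "1 / real (Suc d) - 1 / real (Suc (Suc d)) = 1 / (real (Suc d) * real (Suc (Suc d)))"
        by (simp add: field_simps)
      moreover have "1 / (real (Suc (Suc d)))\<^sup>2 \<le> 1 / (real (Suc d) * real (Suc (Suc d)))"
        unfolding power2_eq_square by (intro divide_left_mono mult_right_mono) auto
      ultimately show ?thesis by simp
    qed
    then show ?case using Suc by simp
  qed simp
  show ?thesis
  proof (cases d)
    case (Suc k)
    have "2 - 1 / real (Suc k) \<le> 2" by simp
    with *[of k] show ?thesis unfolding Suc by linarith
  qed simp
qed

text \<open>Splitting each denominator into (j - i)(j + i), with \<open>Suc j\<close> as j, turns
  the product into factorial quotients. This is the case \<open>d = j\<close> of the weight formula
  below.\<close>

lemma prod_square_ratio_diag:
  "(\<Prod>i\<in>{1..<Suc j}. (real i)\<^sup>2 / ((real (Suc j))\<^sup>2 - (real i)\<^sup>2)) = 2 * fact (Suc j) * fact (Suc j) / fact (Suc j + Suc j)"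
proof -
  have a: "(\<Prod>i\<in>{1..<Suc j}. real i) = fact j"
    by (simp add: fact_prod atLeastLessThanSuc_atLeastAtMost)
  have b: "(\<Prod>i\<in>{1..<Suc j}. real (Suc j) - real i) = fact j"
    unfolding a[symmetric]
    by (rule prod.reindex_bij_witness[where i="\<lambda>i. Suc j - i" and j="\<lambda>i. Suc j - i"]) (auto simp: of_nat_diff)
  have c: "(\<Prod>i\<in>{1..<Suc k}. real (Suc j) + real i) * fact (Suc j) = fact (Suc j + k)" for k
    by (induction k) (auto simp: algebra_simps)
  have c: "(\<Prod>i\<in>{1..<Suc j}. real (Suc j) + real i) = fact (Suc j + j) / fact (Suc j)"
    by (rule nonzero_eq_divide_eq[THEN iffD2, OF fact_nonzero c])
  have "(\<Prod>i\<in>{1..<Suc j}. (real i)\<^sup>2 / ((real (Suc j))\<^sup>2 - (real i)\<^sup>2)) =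
     (\<Prod>i\<in>{1..<Suc j}. real i * real i / ((real (Suc j) - real i) * (real (Suc j) + real i)))"
    by (intro prod.cong) (auto simp: power2_eq_square algebra_simps)
  also have "\<dots> = fact j * fact j / (fact j * (fact (Suc j + j) / fact (Suc j)))"
    by (simp only: prod_dividef prod.distrib a b c)
  also have "\<dots> = 2 * fact (Suc j) * fact (Suc j) / fact (Suc j + Suc j)"
  proof -
    have *: "F * F / (F * (X / (G * F))) = 2 * (G * F) * (G * F) / (2 * G * X)"
      if "F \<noteq> 0" "X \<noteq> 0" "G \<noteq> 0" for F G X :: real
      using that by (simp add: divide_simps)
    have f1: "(fact (Suc j + Suc j) :: real) = 2 * real (Suc j) * fact (Suc j + j)"
      unfolding add_Suc_right fact_Suc[of "Suc j + j"] by simp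
    have f2: "(fact (Suc j) :: real) = real (Suc j) * fact j" by simp
    show ?thesis unfolding f1 f2 by (rule *) simp_all
  qed
  finally show ?thesis .
qed

text \<open>These are the absolute Lagrange weights at 0 for the nodes 1, 4, ..., d^2; the value is
  twice the quotient of the binomials (2d choose d+j) and (2d choose d). Induction on
  \<open>d\<close> from \<open>j\<close> upwards adds one factor at a time.\<close>

lemma prod_square_ratio:
  assumes "1 \<le> j" "j \<le> d"
  shows "(\<Prod>i\<in>{1..d} - {j}. \<bar>(real i)\<^sup>2 / ((real i)\<^sup>2 - (real j)\<^sup>2)\<bar>)
       = 2 * fact d * fact d / (fact (d + j) * fact (d - j))"
  using assms(2)
proof (induction d rule: dec_induct)
  case base
  obtain k where k: "j = Suc k" using assms(1) by (cases j) auto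
  have e: "{1..j} - {j} = {1..<Suc k}" using k by auto
  have "(\<Prod>i\<in>{1..j} - {j}. \<bar>(real i)\<^sup>2 / ((real i)\<^sup>2 - (real j)\<^sup>2)\<bar>)
      = (\<Prod>i\<in>{1..<Suc k}. (real i)\<^sup>2 / ((real (Suc k))\<^sup>2 - (real i)\<^sup>2))"
    unfolding e
  proof (rule prod.cong)
    fix i assume "i \<in> {1..<Suc k}"
    then have "(real i)\<^sup>2 < (real (Suc k))\<^sup>2" by (intro power_strict_mono) auto
    then have "\<bar>(real i)\<^sup>2 - (real j)\<^sup>2\<bar> = (real (Suc k))\<^sup>2 - (real i)\<^sup>2"
      unfolding k by linarith
    then show "\<bar>(real i)\<^sup>2 / ((real i)\<^sup>2 - (real j)\<^sup>2)\<bar> = (real i)\<^sup>2 / ((real (Suc k))\<^sup>2 - (real i)\<^sup>2)"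
      unfolding abs_divide by simp
  qed simp
  also have "\<dots> = 2 * fact j * fact j / (fact (j + j) * fact (j - j))"
    unfolding k prod_square_ratio_diag[of k] by simp
  finally show ?case .
next
  case (step d)
  have e: "{1..Suc d} - {j} = insert (Suc d) ({1..d} - {j})" using step by auto
  have pos: "(real j)\<^sup>2 < (real (Suc d))\<^sup>2" using step by (intro power_strict_mono) auto
  define s where "s = real (Suc d) - real j"
  have s: "s > 0" using step by (simp add: s_def)
  have f1: "(fact (Suc d - j) :: real) = s * fact (d - j)"
    using step by (simp add: s_def Suc_diff_le of_nat_diff)
  have f2: "(fact (Suc d + j) :: real) = (real (Suc d) + real j) * fact (d + j)"
    by (simp add: algebra_simps)
  have "(\<Prod>i\<in>{1..Suc d} - {j}. \<bar>(real i)\<^sup>2 / ((real i)\<^sup>2 - (real j)\<^sup>2)\<bar>)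
     = (real (Suc d))\<^sup>2 / ((real (Suc d))\<^sup>2 - (real j)\<^sup>2) * (2 * fact d * fact d / (fact (d + j) * fact (d - j)))"
    unfolding e using step.IH pos by (subst prod.insert) (auto simp: abs_divide)
  also have "(real (Suc d))\<^sup>2 - (real j)\<^sup>2 = s * (real (Suc d) + real j)"
    by (simp add: s_def power2_eq_square algebra_simps)
  also have "(real (Suc d))\<^sup>2 / (s * (real (Suc d) + real j)) * (2 * fact d * fact d / (fact (d + j) * fact (d - j)))
     = 2 * fact (Suc d) * fact (Suc d) / (fact (Suc d + j) * fact (Suc d - j))"
    unfolding f1 f2 using s by (simp add: power2_eq_square algebra_simps)
  finally show ?case .
qed

text \<open>The central binomial coefficient is the largest one, so the weights above are at most
  2.\<close>

lemma fact_mult_fact_le: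
  assumes "j \<le> d"
  shows "(fact d * fact d :: real) \<le> fact (d + j) * fact (d - j)"
  using assms
proof (induction j)
  case (Suc j)
  have "(fact (d - j) :: real) = real (d - j) * fact (d - Suc j)"
    using Suc.prems by (metis Suc_diff_Suc Suc_le_lessD fact_Suc of_nat_fact of_nat_mult)
  also have "\<dots> \<le> real (d + Suc j) * fact (d - Suc j)" by (intro mult_right_mono) auto
  finally have "fact (d + j) * (fact (d - j) :: real) \<le> fact (d + j) * (real (d + Suc j) * fact (d - Suc j))"
    by (intro mult_left_mono) auto
  with Suc show ?case by (simp add: algebra_simps)
qed simp

lemma lagrange_interpolation_at_0:
  fixes Q :: "real poly" and x :: "'i \<Rightarrow> real"
  assumes fin: "finite J" and inj: "inj_on x J" and deg: "degree Q < card J"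
  shows "poly Q 0 = (\<Sum>j\<in>J. poly Q (x j) * (\<Prod>i\<in>J - {j}. x i / (x i - x j)))"
proof -
  define L where "L j = (\<Prod>i\<in>J - {j}. smult (1 / (x i - x j)) [:x i, -1:])" for j
  define R where "R = (\<Sum>j\<in>J. smult (poly Q (x j)) (L j))"
  have Lv: "poly (L j) t = (\<Prod>i\<in>J - {j}. (x i - t) / (x i - x j))" for j t
    unfolding L_def poly_prod by (intro prod.cong) (auto simp: diff_divide_distrib)
  have LL: "poly (L j) (x k) = (if j = k then 1 else 0)" if "j \<in> J" "k \<in> J" for j k
  proof (cases "j = k")
    case True
    have "(\<Prod>i\<in>J - {j}. (x i - x j) / (x i - x j)) = 1"
      using inj that by (intro prod.neutral) (auto simp: inj_on_def)
    then show ?thesis using True by (simp add: Lv)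
  next
    case False
    then show ?thesis using that fin by (auto simp: Lv)
  qed
  have degL: "degree (L j) < card J" if "j \<in> J" for j
  proof -
    have "degree (L j) \<le> (\<Sum>i\<in>J - {j}. degree (smult (1 / (x i - x j)) [:x i, -1:]))"
      unfolding L_def by (rule degree_prod_sum_le[OF finite_Diff[OF fin], unfolded o_def])
    also have "\<dots> \<le> (\<Sum>i\<in>J - {j}. 1)" by (intro sum_mono) (simp add: degree_smult_le)
    also have "\<dots> < card J" using card_Diff1_less[OF fin that] by simp
    finally show ?thesis .
  qed
  have "degree R \<le> card J - 1"
    unfolding R_def using degL by (intro degree_sum_le fin order.trans[OF degree_smult_le]) force
  \<comment> \<open>\<open>deg\<close> forces \<open>card J\<close> to be positive, so the truncated
    subtraction is harmless.\<close>
  then have degR: "degree R < card J" using deg by linarith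
  have "R = Q"
  proof (rule poly_eqI_degree[of "x ` J"])
    fix t assume "t \<in> x ` J"
    then obtain k where k: "k \<in> J" "t = x k" by auto
    have "poly R t = (\<Sum>j\<in>J. if j = k then poly Q (x j) else 0)"
      unfolding R_def k poly_sum using LL k by (intro sum.cong) auto
    then show "poly R t = poly Q t" using k fin by simp
  qed (use deg degR inj in \<open>auto simp: card_image\<close>)
  moreover have "poly R 0 = (\<Sum>j\<in>J. poly Q (x j) * (\<Prod>i\<in>J - {j}. x i / (x i - x j)))"
    by (simp add: R_def poly_sum Lv)
  ultimately show ?thesis by simp
qed

text \<open>With P = a + t Q the coefficient is P'(0) = Q(0), and \<open>d\<close> nodes determine
  \<open>Q\<close>. A node x contributes at most 2 (the weight) times 2 / x (the bound on
  \<open>Q\<close> there), and the inverse squares sum to at most 2.\<close>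

lemma markov_inequality_at_0:
  fixes P :: "real poly"
  assumes deg: "degree P \<le> d" and bd: "\<And>t. 0 \<le> t \<Longrightarrow> t \<le> 1 \<Longrightarrow> \<bar>poly P t\<bar> \<le> 1"
  shows "\<bar>coeff P 1\<bar> \<le> 8 * (real d)\<^sup>2"
proof (cases "d = 0")
  case True
  then show ?thesis using deg by (simp add: coeff_eq_0)
next
  case False
  obtain a Q where P: "P = pCons a Q" by (cases P)
  have degQ: "degree Q < d" using deg False by (auto simp: P degree_pCons_eq_if split: if_splits)
  \<comment> \<open>The nodes lie in (0, 1] and crowd quadratically towards 0, like Chebyshev nodes.
    The scaling by d^2 cancels in the weights.\<close>
  define x where "x j = (real j)\<^sup>2 / (real d)\<^sup>2" for j :: nat
  have inj: "inj_on x {1..d}"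
    using False by (auto simp: inj_on_def x_def power2_eq_iff)
  have "coeff P 1 = poly Q 0" by (simp add: P poly_0_coeff_0)
  also have "\<dots> = (\<Sum>j\<in>{1..d}. poly Q (x j) * (\<Prod>i\<in>{1..d} - {j}. x i / (x i - x j)))"
    using inj degQ by (intro lagrange_interpolation_at_0) auto
  finally have "\<bar>coeff P 1\<bar> \<le> (\<Sum>j\<in>{1..d}. \<bar>poly Q (x j) * (\<Prod>i\<in>{1..d} - {j}. x i / (x i - x j))\<bar>)"
    by (simp add: sum_abs)
  also have "\<dots> \<le> (\<Sum>j\<in>{1..d}. 4 * (real d)\<^sup>2 * (1 / (real j)\<^sup>2))"
  proof (rule sum_mono)
    fix j assume j: "j \<in> {1..d}"
    have xj: "0 < x j" "x j \<le> 1"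
      using j by (auto simp: x_def divide_le_eq power_mono)
    have "a + x j * poly Q (x j) = poly P (x j)" "a = poly P 0" by (simp_all add: P)
    then have "\<bar>x j * poly Q (x j)\<bar> \<le> 2" using bd[of "x j"] bd[of 0] xj by auto
    then have "\<bar>poly Q (x j)\<bar> \<le> 2 / x j" using xj by (simp add: abs_mult field_simps)
    then have 1: "\<bar>poly Q (x j)\<bar> \<le> 2 * (real d)\<^sup>2 * (1 / (real j)\<^sup>2)" by (simp add: x_def)
    have "\<bar>\<Prod>i\<in>{1..d} - {j}. x i / (x i - x j)\<bar> = (\<Prod>i\<in>{1..d} - {j}. \<bar>(real i)\<^sup>2 / ((real i)\<^sup>2 - (real j)\<^sup>2)\<bar>)"
      unfolding abs_prod using False
      by (intro prod.cong) (auto simp: x_def diff_divide_distrib[symmetric])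
    also have "\<dots> = 2 * fact d * fact d / (fact (d + j) * fact (d - j))"
      using j by (intro prod_square_ratio) auto
    also have "\<dots> \<le> 2" using fact_mult_fact_le[of j d] j by (simp add: divide_le_eq)
    finally have 2: "\<bar>\<Prod>i\<in>{1..d} - {j}. x i / (x i - x j)\<bar> \<le> 2" .
    have "\<bar>poly Q (x j) * (\<Prod>i\<in>{1..d} - {j}. x i / (x i - x j))\<bar> \<le> (2 * (real d)\<^sup>2 * (1 / (real j)\<^sup>2)) * 2"
      unfolding abs_mult by (intro mult_mono 1 2) auto
    then show "\<bar>poly Q (x j) * (\<Prod>i\<in>{1..d} - {j}. x i / (x i - x j))\<bar> \<le> 4 * (real d)\<^sup>2 * (1 / (real j)\<^sup>2)"
      by simp
  qed
  also have "\<dots> = 4 * (real d)\<^sup>2 * (\<Sum>j=1..d. 1 / (real j)\<^sup>2)" by (simp only: sum_distrib_left)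
  also have "\<dots> \<le> 4 * (real d)\<^sup>2 * 2" by (intro mult_left_mono sum_inverse_squares_le) auto
  finally show ?thesis by simp
qed

subsection \<open>Degree of functions on the cube\<close>

text \<open>
  A point of the cube is identified with the set \<open>X\<close> of its one-coordinates, so that the
  multilinear monomial with variable set \<open>S\<close> takes the value \<open>of_bool (S \<subseteq> X)\<close> at \<open>X\<close>.
\<close>

definition ml_degree_le :: "'a set \<Rightarrow> nat \<Rightarrow> ('a set \<Rightarrow> real) \<Rightarrow> bool" where
  "ml_degree_le V d g \<longleftrightarrow>
     (\<exists>c. (\<forall>S. d < card S \<longrightarrow> c S = 0) \<and> (\<forall>X. X \<subseteq> V \<longrightarrow> g X = (\<Sum>S\<in>Pow X. c S)))"

lemma ml_degree_le_cong:
  assumes "ml_degree_le V d g" and "\<And>X. X \<subseteq> V \<Longrightarrow> h X = g X"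
  shows "ml_degree_le V d h"
  using assms unfolding ml_degree_le_def by metis

lemma ml_degree_le_monomial:
  assumes "finite V" "card S \<le> d"
  shows "ml_degree_le V d (\<lambda>X. of_bool (S \<subseteq> X))"
  unfolding ml_degree_le_def
proof (intro exI[of _ "\<lambda>R. of_bool (R = S)"] conjI allI impI)
  fix X assume "X \<subseteq> V"
  then have "finite (Pow X)" using assms(1) finite_subset by auto
  then show "of_bool (S \<subseteq> X) = (\<Sum>R\<in>Pow X. of_bool (R = S) :: real)"
    by (simp add: of_bool_def)
qed (use assms in auto)

lemma ml_degree_le_scale:
  assumes "ml_degree_le V d g"
  shows "ml_degree_le V d (\<lambda>X. a * g X)"
proof -
  obtain c where "\<forall>S. d < card S \<longrightarrow> c S = 0" "\<forall>X. X \<subseteq> V \<longrightarrow> g X = (\<Sum>S\<in>Pow X. c S)"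
    using assms unfolding ml_degree_le_def by auto
  then show ?thesis
    unfolding ml_degree_le_def by (intro exI[of _ "\<lambda>S. a * c S"]) (auto simp: sum_distrib_left)
qed

lemma ml_degree_le_add:
  assumes "ml_degree_le V d g" "ml_degree_le V d h"
  shows "ml_degree_le V d (\<lambda>X. g X + h X)"
proof -
  obtain c where "\<forall>S. d < card S \<longrightarrow> c S = 0" "\<forall>X. X \<subseteq> V \<longrightarrow> g X = (\<Sum>S\<in>Pow X. c S)"
    using assms(1) unfolding ml_degree_le_def by auto
  moreover obtain c' where "\<forall>S. d < card S \<longrightarrow> c' S = 0" "\<forall>X. X \<subseteq> V \<longrightarrow> h X = (\<Sum>S\<in>Pow X. c' S)"
    using assms(2) unfolding ml_degree_le_def by auto
  ultimately show ?thesis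
    unfolding ml_degree_le_def by (intro exI[of _ "\<lambda>S. c S + c' S"]) (auto simp: sum.distrib)
qed

lemma ml_degree_le_const:
  assumes "finite V"
  shows "ml_degree_le V d (\<lambda>X. a)"
  using ml_degree_le_scale[OF ml_degree_le_monomial[OF assms, of "{}" d], of a] by simp

lemma ml_degree_le_sum:
  assumes "finite V" "\<And>i. i \<in> I \<Longrightarrow> ml_degree_le V d (g i)"
  shows "ml_degree_le V d (\<lambda>X. \<Sum>i\<in>I. g i X)"
  using assms(2)
proof (induction I rule: infinite_finite_induct)
  case (insert i I)
  then show ?case using ml_degree_le_add[of V d "g i" "\<lambda>X. \<Sum>i\<in>I. g i X"] by simp
qed (simp_all add: ml_degree_le_const assms(1))

text \<open>The sum over \<open>Pow X\<close> serves to read off coefficients; the sum over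
  \<open>Pow V\<close> has a fixed index set and can be exchanged with other sums.\<close>

lemma ml_degree_leE:
  assumes "ml_degree_le V d g" "finite V"
  obtains c where "\<And>S. d < card S \<Longrightarrow> c S = 0"
    and "\<And>X. X \<subseteq> V \<Longrightarrow> g X = (\<Sum>S\<in>Pow X. c S)"
    and "\<And>X. X \<subseteq> V \<Longrightarrow> g X = (\<Sum>S\<in>Pow V. c S * of_bool (S \<subseteq> X))"
proof -
  obtain c where c: "\<forall>S. d < card S \<longrightarrow> c S = 0" "\<forall>X. X \<subseteq> V \<longrightarrow> g X = (\<Sum>S\<in>Pow X. c S)"
    using assms(1) unfolding ml_degree_le_def by auto
  have "g X = (\<Sum>S\<in>Pow V. c S * of_bool (S \<subseteq> X))" if "X \<subseteq> V" for X
  proof -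
    have "(\<Sum>S\<in>Pow X. c S) = (\<Sum>S\<in>Pow V. c S * of_bool (S \<subseteq> X))"
      using that assms(2) by (intro sum.mono_neutral_cong_left) auto
    then show ?thesis using c that by simp
  qed
  with c show thesis by (intro that[of c]) auto
qed

text \<open>On 0/1 points the product of the monomials \<open>S\<close> and \<open>R\<close> is the
  monomial \<open>S \<union> R\<close>, of size at most \<open>card S + card R\<close>.\<close>

lemma ml_degree_le_mult:
  assumes "finite V" "ml_degree_le V d g" "ml_degree_le V e h"
  shows "ml_degree_le V (d + e) (\<lambda>X. g X * h X)"
proof -
  obtain c where c: "\<And>S. d < card S \<Longrightarrow> c S = 0"
     "\<And>X. X \<subseteq> V \<Longrightarrow> g X = (\<Sum>S\<in>Pow V. c S * of_bool (S \<subseteq> X))"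
    using ml_degree_leE[OF assms(2,1)] by metis
  obtain c' where c': "\<And>S. e < card S \<Longrightarrow> c' S = 0"
     "\<And>X. X \<subseteq> V \<Longrightarrow> h X = (\<Sum>S\<in>Pow V. c' S * of_bool (S \<subseteq> X))"
    using ml_degree_leE[OF assms(3,1)] by metis
  have m: "ml_degree_le V (d + e) (\<lambda>X. (c S * c' R) * of_bool (S \<union> R \<subseteq> X))" for S R
  proof (cases "c S * c' R = 0")
    case True
    then show ?thesis using ml_degree_le_const[OF assms(1), of "d + e" 0] by auto
  next
    case False
    then have "card S \<le> d" "card R \<le> e" using c(1) c'(1) by force+
    then have "card (S \<union> R) \<le> d + e" using card_Un_le[of S R] by linarith
    then show ?thesis by (intro ml_degree_le_scale ml_degree_le_monomial assms(1))
  qed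
  have "ml_degree_le V (d + e) (\<lambda>X. \<Sum>S\<in>Pow V. \<Sum>R\<in>Pow V. (c S * c' R) * of_bool (S \<union> R \<subseteq> X))"
    by (intro ml_degree_le_sum assms(1) m)
  then show ?thesis
  proof (rule ml_degree_le_cong)
    fix X assume "X \<subseteq> V"
    then show "g X * h X = (\<Sum>S\<in>Pow V. \<Sum>R\<in>Pow V. (c S * c' R) * of_bool (S \<union> R \<subseteq> X))"
      unfolding c(2)[OF \<open>X \<subseteq> V\<close>] c'(2)[OF \<open>X \<subseteq> V\<close>] sum_product
      by (intro sum.cong) auto
  qed
qed

lemma ml_degree_le_prod:
  assumes "finite V" "finite S" "\<And>s. s \<in> S \<Longrightarrow> ml_degree_le V 1 (g s)"
  shows "ml_degree_le V (card S) (\<lambda>X. \<Prod>s\<in>S. g s X)"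
  using assms(2,3)
proof (induction S rule: finite_induct)
  case empty
  then show ?case using ml_degree_le_const[OF assms(1)] by simp
next
  case (insert s S)
  then show ?case
    using ml_degree_le_mult[OF assms(1), of 1 "g s" "card S" "\<lambda>X. \<Prod>s\<in>S. g s X"] by simp
qed

lemma ml_degree_le_mono:
  assumes "ml_degree_le V d g" "d \<le> e"
  shows "ml_degree_le V e g"
  using assms unfolding ml_degree_le_def by (meson le_less_trans)

lemma ml_degree_le_literal:
  assumes "finite V"
  shows "ml_degree_le V 1 (\<lambda>X. of_bool (i \<in> X))" "ml_degree_le V 1 (\<lambda>X. of_bool (i \<notin> X))"
proof -
  show *: "ml_degree_le V 1 (\<lambda>X. of_bool (i \<in> X))"
    using ml_degree_le_monomial[OF assms, of "{i}" 1] by simp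
  have "ml_degree_le V 1 (\<lambda>X. 1 + (-1) * of_bool (i \<in> X))"
    by (intro ml_degree_le_add ml_degree_le_scale * ml_degree_le_const assms)
  then show "ml_degree_le V 1 (\<lambda>X. of_bool (i \<notin> X))"
    by (rule ml_degree_le_cong) auto
qed

text \<open>A monomial \<open>S\<close> turns into a product of \<open>card S\<close> factors of
  degree at most 1. Both block flips and restrictions to subcubes are substitutions of this
  kind.\<close>

lemma ml_degree_le_compose:
  assumes "finite U" "finite V" "ml_degree_le V d g"
    and "\<And>Y. Y \<subseteq> U \<Longrightarrow> h Y \<subseteq> V"
    and lit: "\<And>s. s \<in> V \<Longrightarrow> ml_degree_le U 1 (\<lambda>Y. of_bool (s \<in> h Y))"
  shows "ml_degree_le U d (\<lambda>Y. g (h Y))"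
proof -
  obtain c where c: "\<And>S. d < card S \<Longrightarrow> c S = 0"
     "\<And>X. X \<subseteq> V \<Longrightarrow> g X = (\<Sum>S\<in>Pow V. c S * of_bool (S \<subseteq> X))"
    using ml_degree_leE[OF assms(3,2)] by metis
  have "ml_degree_le U d (\<lambda>Y. c S * of_bool (S \<subseteq> h Y))" if "S \<in> Pow V" for S
  proof (cases "c S = 0")
    case True
    then show ?thesis using ml_degree_le_const[OF assms(1), of d 0] by auto
  next
    case False
    then have "card S \<le> d" using c(1) by force
    have fin: "finite S" using that assms(2) finite_subset by auto
    have "ml_degree_le U (card S) (\<lambda>Y. \<Prod>s\<in>S. of_bool (s \<in> h Y))"
      using lit that by (intro ml_degree_le_prod assms(1) fin) auto
    moreover have "(\<Prod>s\<in>S. of_bool (s \<in> h Y)) = (of_bool (S \<subseteq> h Y) :: real)" for Y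
      using fin by (induction S rule: finite_induct) auto
    ultimately have "ml_degree_le U (card S) (\<lambda>Y. of_bool (S \<subseteq> h Y))" by simp
    then show ?thesis using \<open>card S \<le> d\<close> by (intro ml_degree_le_scale) (rule ml_degree_le_mono)
  qed
  then have "ml_degree_le U d (\<lambda>Y. \<Sum>S\<in>Pow V. c S * of_bool (S \<subseteq> h Y))"
    by (intro ml_degree_le_sum assms(1))
  then show ?thesis by (rule ml_degree_le_cong) (use c(2) assms(4) in auto)
qed

text \<open>Expand \<open>g\<close> into point indicators, each a product of one literal per
  variable.\<close>

lemma ml_degree_le_card:
  assumes "finite V"
  shows "ml_degree_le V (card V) g"
proof -
  have lit: "ml_degree_le V 1 (\<lambda>X. of_bool ((s \<in> X) = (s \<in> A)))" for s A
    using ml_degree_le_literal[OF assms, of s] by (cases "s \<in> A") simp_all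
  have "ml_degree_le V (card V) (\<lambda>X. \<Sum>A\<in>Pow V. g A * (\<Prod>s\<in>V. of_bool ((s \<in> X) = (s \<in> A))))"
    by (intro ml_degree_le_sum ml_degree_le_scale ml_degree_le_prod assms lit)
  then show ?thesis
  proof (rule ml_degree_le_cong)
    fix X assume X: "X \<subseteq> V"
    have "(\<Prod>s\<in>V. of_bool ((s \<in> X) = (s \<in> A))) = (if A = X then 1 else 0 :: real)" if "A \<in> Pow V" for A
    proof (cases "A = X")
      case False
      then obtain s where "s \<in> V" "(s \<in> X) \<noteq> (s \<in> A)" using X \<open>A \<in> Pow V\<close> by blast
      then show ?thesis using False assms by (auto intro!: prod_zero)
    qed simp
    then have "(\<Sum>A\<in>Pow V. g A * (\<Prod>s\<in>V. of_bool ((s \<in> X) = (s \<in> A)))) =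
        (\<Sum>A\<in>Pow V. if A = X then g A else 0)"
      by (intro sum.cong) auto
    then show "g X = (\<Sum>A\<in>Pow V. g A * (\<Prod>s\<in>V. of_bool ((s \<in> X) = (s \<in> A))))"
      using X assms by simp
  qed
qed

section \<open>Random flips of disjoint blocks at a maximum\<close>

lemma sum_Pow_binomial_weights:
  fixes t :: real
  assumes "finite I" "S \<subseteq> I"
  shows "(\<Sum>T\<in>Pow I. of_bool (S \<subseteq> T) * (t ^ card T * (1 - t) ^ card (I - T))) = t ^ card S"
proof -
  \<comment> \<open>The value 0 on \<open>S\<close> kills exactly the summands with \<open>S\<close>
    not inside \<open>T\<close>, so one expanded product accounts for the indicator.\<close>
  define b where "b i = (if i \<in> S then 0 else 1 - t)" for i
  have "(\<Prod>i\<in>I. t + b i) = (\<Prod>i\<in>I. if i \<in> S then t else 1)"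
    by (intro prod.cong) (auto simp: b_def)
  also have "\<dots> = (\<Prod>i\<in>S. t)"
    using assms by (simp add: prod.If_cases Int_absorb1)
  also have "\<dots> = t ^ card S" by simp
  also have "(\<Prod>i\<in>I. t + b i) = (\<Sum>T\<in>Pow I. (\<Prod>i\<in>T. t) * (\<Prod>i\<in>I - T. b i))"
    using assms(1) by (rule prod_add)
  also have "\<dots> = (\<Sum>T\<in>Pow I. of_bool (S \<subseteq> T) * (t ^ card T * (1 - t) ^ card (I - T)))"
  proof (rule sum.cong)
    fix T assume T: "T \<in> Pow I"
    show "(\<Prod>i\<in>T. t) * (\<Prod>i\<in>I - T. b i) = of_bool (S \<subseteq> T) * (t ^ card T * (1 - t) ^ card (I - T))"
    proof (cases "S \<subseteq> T")
      case True
      then have "(\<Prod>i\<in>I - T. b i) = (\<Prod>i\<in>I - T. 1 - t)" by (intro prod.cong) (auto simp: b_def)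
      then show ?thesis using True by simp
    next
      case False
      then have "\<exists>i\<in>I - T. b i = 0" using assms(2) by (auto simp: b_def)
      then have "(\<Prod>i\<in>I - T. b i) = 0" using assms(1) by (intro prod_zero) auto
      then show ?thesis using False by simp
    qed
  qed simp
  finally show ?thesis by simp
qed

text \<open>Normalised block bound: \<open>r T\<close> stands for the quotient by the maximal value
  after flipping the blocks in \<open>T\<close>. The derivative at 0 of its expectation is the sum
  of \<open>r {i} - r {}\<close>, and Markov's inequality limits it.\<close>

lemma sensitivity_at_maximum_le:
  fixes r :: "'i set \<Rightarrow> real"
  assumes fin: "finite I" and deg: "ml_degree_le I d r"
    and bd: "\<And>T. T \<subseteq> I \<Longrightarrow> \<bar>r T\<bar> \<le> 1" and r0: "r {} = 1"
    and r1: "\<And>i. i \<in> I \<Longrightarrow> \<bar>r {i}\<bar> \<le> \<epsilon>"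
  shows "real (card I) * (1 - \<epsilon>) \<le> 8 * (real d)\<^sup>2"
proof -
  obtain c where c: "\<And>S. d < card S \<Longrightarrow> c S = 0"
     "\<And>X. X \<subseteq> I \<Longrightarrow> r X = (\<Sum>S\<in>Pow X. c S)"
     "\<And>X. X \<subseteq> I \<Longrightarrow> r X = (\<Sum>S\<in>Pow I. c S * of_bool (S \<subseteq> X))"
    using ml_degree_leE[OF deg fin] by metis
  \<comment> \<open>\<open>poly P t\<close> is the expectation of \<open>r T\<close> when \<open>T\<close> contains each element of \<open>I\<close>
      independently with probability \<open>t\<close>.\<close>
  define P where "P = (\<Sum>S\<in>Pow I. monom (c S) (card S))"
  define w where "w t T = t ^ card T * (1 - t) ^ card (I - T)" for t :: real and T
  have "degree P \<le> d"
    unfolding P_def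
  proof (rule degree_sum_le)
    fix S
    show "degree (monom (c S) (card S)) \<le> d"
      using c(1)[of S] degree_monom_le[of "c S" "card S"] by (cases "d < card S") auto
  qed (use fin in auto)
  moreover have "\<bar>poly P t\<bar> \<le> 1" if t: "0 \<le> t" "t \<le> 1" for t
  proof -
    have "poly P t = (\<Sum>S\<in>Pow I. c S * (\<Sum>T\<in>Pow I. of_bool (S \<subseteq> T) * w t T))"
      unfolding P_def poly_sum w_def
      by (intro sum.cong refl) (simp add: poly_monom sum_Pow_binomial_weights[OF fin])
    also have "\<dots> = (\<Sum>T\<in>Pow I. \<Sum>S\<in>Pow I. c S * of_bool (S \<subseteq> T) * w t T)"
      by (subst sum.swap) (simp add: sum_distrib_left mult.assoc)
    also have "\<dots> = (\<Sum>T\<in>Pow I. r T * w t T)"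
      by (intro sum.cong refl) (simp add: c(3) sum_distrib_right)
    finally have "\<bar>poly P t\<bar> \<le> (\<Sum>T\<in>Pow I. \<bar>r T * w t T\<bar>)" by simp
    also have "\<dots> \<le> (\<Sum>T\<in>Pow I. 1 * w t T)"
    proof (rule sum_mono)
      fix T assume "T \<in> Pow I"
      moreover have "0 \<le> w t T" using t by (simp add: w_def)
      ultimately show "\<bar>r T * w t T\<bar> \<le> 1 * w t T"
        using bd[of T] unfolding abs_mult by (intro mult_mono) auto
    qed
    also have "\<dots> = 1" using sum_Pow_binomial_weights[OF fin, of "{}" t] by (simp add: w_def)
    finally show ?thesis .
  qed
  ultimately have "\<bar>coeff P 1\<bar> \<le> 8 * (real d)\<^sup>2" by (rule markov_inequality_at_0)
  moreover have "coeff P 1 = (\<Sum>i\<in>I. r {i} - 1)"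
  proof -
    have ci: "c {i} = r {i} - 1" if "i \<in> I" for i
    proof -
      have "r {i} = c {} + c {i}" using c(2)[of "{i}"] that by (simp add: Pow_insert)
      moreover have "c {} = 1" using c(2)[of "{}"] r0 by simp
      ultimately show ?thesis by simp
    qed
    have "coeff P 1 = (\<Sum>S\<in>Pow I. if card S = 1 then c S else 0)"
      unfolding P_def coeff_sum by (intro sum.cong) auto
    also have "\<dots> = (\<Sum>S\<in>{S\<in>Pow I. card S = 1}. c S)"
      using fin by (intro sum.inter_filter[symmetric]) auto
    also have "{S\<in>Pow I. card S = 1} = (\<lambda>i. {i}) ` I" by (auto simp: card_1_singleton_iff)
    also have "(\<Sum>S\<in>(\<lambda>i. {i}) ` I. c S) = (\<Sum>i\<in>I. c {i})"
      by (subst sum.reindex) (auto simp: inj_on_def)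
    finally show ?thesis using ci by simp
  qed
  moreover have "(\<Sum>i\<in>I. r {i} - 1) \<le> (\<Sum>i\<in>I. \<epsilon> - 1)"
    using r1 by (intro sum_mono) (simp add: abs_le_iff)
  ultimately show ?thesis by (simp add: algebra_simps)
qed

text \<open>By disjointness a coordinate of the flipped point depends on the choice for at most one
  block, so passing from points to sets of blocks does not raise the degree.\<close>

lemma disjoint_blocks_at_maximum_le:
  fixes p :: "'a set \<Rightarrow> real" and B :: "'i \<Rightarrow> 'a set"
  assumes finV: "finite V" and finI: "finite I" and deg: "ml_degree_le V d p"
    and z: "z \<subseteq> V" and B: "\<And>i. i \<in> I \<Longrightarrow> B i \<subseteq> V"
    and disj: "\<And>i j. i \<in> I \<Longrightarrow> j \<in> I \<Longrightarrow> i \<noteq> j \<Longrightarrow> B i \<inter> B j = {}"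
    and pz: "1 \<le> \<bar>p z\<bar>" and max: "\<And>X. X \<subseteq> V \<Longrightarrow> \<bar>p X\<bar> \<le> \<bar>p z\<bar>"
    and small: "\<And>i. i \<in> I \<Longrightarrow> \<bar>p ((z - B i) \<union> (B i - z))\<bar> \<le> \<epsilon>"
  shows "real (card I) * (1 - \<epsilon>) \<le> 8 * (real d)\<^sup>2"
proof -
  define h where "h T = (z - (\<Union>i\<in>T. B i)) \<union> ((\<Union>i\<in>T. B i) - z)" for T
  have hV: "h T \<subseteq> V" if "T \<subseteq> I" for T using z B that unfolding h_def by blast
  have lit: "ml_degree_le I 1 (\<lambda>T. of_bool (s \<in> h T))" for s
  proof (cases "\<exists>i\<in>I. s \<in> B i")
    case True
    then obtain i where i: "i \<in> I" "s \<in> B i" by blast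
    have U: "s \<in> (\<Union>i\<in>T. B i) \<longleftrightarrow> i \<in> T" if "T \<subseteq> I" for T using i disj that by blast
    have "ml_degree_le I 1 (\<lambda>T. of_bool (if s \<in> z then i \<notin> T else i \<in> T))"
      using ml_degree_le_literal[OF finI, of i] by (cases "s \<in> z") simp_all
    then show ?thesis
    proof (rule ml_degree_le_cong)
      fix T assume "T \<subseteq> I"
      then show "of_bool (s \<in> h T) = (of_bool (if s \<in> z then i \<notin> T else i \<in> T) :: real)"
        using U[of T] unfolding h_def by auto
    qed
  next
    case False
    then have *: "s \<in> h T \<longleftrightarrow> s \<in> z" if "T \<subseteq> I" for T using that unfolding h_def by blast
    have "ml_degree_le I 1 (\<lambda>T. of_bool (s \<in> z))" by (rule ml_degree_le_const[OF finI])
    then show ?thesis by (rule ml_degree_le_cong) (simp add: *)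
  qed
  have "ml_degree_le I d (\<lambda>T. 1 / p z * p (h T))"
    using hV by (intro ml_degree_le_scale ml_degree_le_compose[OF finI finV deg _ lit])
  then show ?thesis
  proof (rule sensitivity_at_maximum_le[OF finI])
    fix T assume "T \<subseteq> I"
    then show "\<bar>1 / p z * p (h T)\<bar> \<le> 1"
      using max[OF hV[of T]] pz by (simp add: abs_mult divide_le_eq)
  next
    show "1 / p z * p (h {}) = 1" using pz by (auto simp: h_def)
  next
    fix i assume i: "i \<in> I"
    have "\<bar>1 / p z * p (h {i})\<bar> = \<bar>p (h {i})\<bar> / \<bar>p z\<bar>" by (simp add: abs_mult)
    \<comment> \<open>Normalising divides by a number at least 1, which preserves the bound
      \<open>\<epsilon>\<close>.\<close>
    also have "\<dots> \<le> \<bar>p (h {i})\<bar> / 1" using pz by (intro divide_left_mono) auto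
    also have "\<dots> \<le> \<epsilon>" using small[OF i] by (simp add: h_def)
    finally show "\<bar>1 / p z * p (h {i})\<bar> \<le> \<epsilon>" .
  qed
qed

section \<open>Flippable blocks inside top-degree monomials\<close>

lemma sum_Pow_eq_0_imp_eq_0:
  fixes c :: "'a set \<Rightarrow> real"
  assumes "finite S" "\<And>Y. Y \<subseteq> S \<Longrightarrow> (\<Sum>R\<in>Pow Y. c R) = 0" "Y \<subseteq> S"
  shows "c Y = 0"
proof -
  have "finite Y" using assms finite_subset by auto
  then show ?thesis using assms(3)
  proof (induction Y rule: finite_psubset_induct)
    case (psubset Y)
    \<comment> \<open>Uniqueness of multilinear coefficients: the induction hypothesis removes all
      proper subsets and leaves \<open>c Y\<close> alone.\<close>
    have "(\<Sum>R\<in>Pow Y. c R) = c Y + (\<Sum>R\<in>Pow Y - {Y}. c R)"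
      using psubset by (intro sum.remove) auto
    moreover have "(\<Sum>R\<in>Pow Y - {Y}. c R) = 0"
      using psubset by (intro sum.neutral) blast
    ultimately show ?case using assms(2)[OF psubset.prems] by simp
  qed
qed

lemma sum_Pow_disjoint_Un:
  assumes "A \<inter> B = {}"
  shows "(\<Sum>R\<in>Pow (A \<union> B). c R) = (\<Sum>R\<in>Pow A. \<Sum>R'\<in>Pow B. c (R \<union> R'))"
proof -
  have "(\<Sum>R\<in>Pow (A \<union> B). c R) = (\<Sum>x\<in>Pow A \<times> Pow B. c (fst x \<union> snd x))"
    by (rule sum.reindex_bij_witness[where i="\<lambda>x. fst x \<union> snd x" and j="\<lambda>R. (R \<inter> A, R \<inter> B)"])
       (use assms in \<open>auto simp: Int_Un_distrib2 intro!: arg_cong[of _ _ c]\<close>)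
  also have "\<dots> = (\<Sum>R\<in>Pow A. \<Sum>R'\<in>Pow B. c (R \<union> R'))"
    by (simp add: sum.cartesian_product case_prod_beta)
  finally show ?thesis .
qed

text \<open>Fix the variables outside \<open>S\<close> as in \<open>z\<close>. Only strict supersets
  of \<open>S\<close> could disturb its coefficient, and these exceed the degree; so the restricted
  polynomial is not identically zero.\<close>

lemma max_monomial_contains_nonvanishing_flip:
  fixes c :: "'a set \<Rightarrow> real"
  assumes "finite V" and deg: "\<And>R. e < card R \<Longrightarrow> c R = 0"
    and S: "S \<subseteq> V" "card S = e" "c S \<noteq> 0" and z: "z \<subseteq> V"
  shows "\<exists>B\<subseteq>S. (\<Sum>R\<in>Pow ((z - B) \<union> (B - z)). c R) \<noteq> 0"
proof (rule ccontr)
  assume "\<not> ?thesis"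
  then have vanish: "(\<Sum>R\<in>Pow ((z - B) \<union> (B - z)). c R) = 0" if "B \<subseteq> S" for B using that by blast
  have fin: "finite S" "finite z" using assms finite_subset by auto
  \<comment> \<open>For \<open>R \<subseteq> S\<close> these are the coefficients of the restriction
    to the variables in \<open>S\<close>.\<close>
  define c' where "c' R = (\<Sum>R'\<in>Pow (z - S). c (R \<union> R'))" for R
  have "c' S = 0"
  proof (rule sum_Pow_eq_0_imp_eq_0[OF fin(1)])
    fix Y assume Y: "Y \<subseteq> S"
    \<comment> \<open>Flipping this set replaces the part of \<open>z\<close> inside
      \<open>S\<close> by \<open>Y\<close>.\<close>
    define B where "B = (z \<inter> S - Y) \<union> (Y - z)"
    have "B \<subseteq> S" "(z - B) \<union> (B - z) = Y \<union> (z - S)" using Y unfolding B_def by blast+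
    then have "(\<Sum>R\<in>Pow (Y \<union> (z - S)). c R) = 0" using vanish[of B] by simp
    then show "(\<Sum>R\<in>Pow Y. c' R) = 0"
      unfolding c'_def using Y by (subst (asm) sum_Pow_disjoint_Un) auto
  qed simp
  moreover have "c' S = c (S \<union> {}) + (\<Sum>R'\<in>Pow (z - S) - {{}}. c (S \<union> R'))"
    unfolding c'_def using fin by (intro sum.remove) auto
  moreover have "(\<Sum>R'\<in>Pow (z - S) - {{}}. c (S \<union> R')) = 0"
  proof (intro sum.neutral ballI deg)
    fix R assume R: "R \<in> Pow (z - S) - {{}}"
    then have "S \<subset> S \<union> R" by auto
    moreover have "finite (S \<union> R)" using R fin finite_subset[of R z] by auto
    ultimately show "e < card (S \<union> R)" using S psubset_card_mono by metis
  qed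
  ultimately show False using S by simp
qed

subsection \<open>Decision trees from top-degree monomials\<close>

text \<open>Evaluation on sets lets the recursion pass to the variables \<open>V - W\<close> without
  renumbering list positions.\<close>

primrec dt_eval_set :: "dtree \<Rightarrow> nat set \<Rightarrow> bool" where
  "dt_eval_set (Leaf b) X = b"
| "dt_eval_set (Query i t0 t1) X = (if i \<in> X then dt_eval_set t1 X else dt_eval_set t0 X)"

lemma dt_eval_set_cong:
  assumes "\<And>i. i \<in> dt_queries t \<Longrightarrow> i \<in> X \<longleftrightarrow> i \<in> Y"
  shows "dt_eval_set t X = dt_eval_set t Y"
  using assms by (induction t) auto

lemma dt_eval_eq_dt_eval_set:
  assumes "dt_queries t \<subseteq> {..<n}"
  shows "dt_eval t x = dt_eval_set t {i. i < n \<and> x ! i}"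
  using assms by (induction t) auto

text \<open>A complete tree over \<open>W\<close> whose leaves are replaced by the continuations
  \<open>t Z\<close>, one for each set \<open>Z\<close> of positive answers.\<close>

lemma dtree_query_all:
  assumes "finite W" "W \<subseteq> V"
    and "\<And>Z. Z \<subseteq> W \<Longrightarrow> dt_queries (t Z) \<subseteq> V \<and> dt_depth (t Z) \<le> m"
  shows "\<exists>u. dt_queries u \<subseteq> V \<and> dt_depth u \<le> card W + m \<and>
             (\<forall>X. dt_eval_set u X = dt_eval_set (t (X \<inter> W)) X)"
  using assms
proof (induction W arbitrary: t rule: finite_induct)
  case empty
  then show ?case by (intro exI[of _ "t {}"]) auto
next
  case (insert i W)
  have "\<exists>u. dt_queries u \<subseteq> V \<and> dt_depth u \<le> card W + m \<and> (\<forall>X. dt_eval_set u X = dt_eval_set (t (X \<inter> W)) X)"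
    using insert.prems by (intro insert.IH) auto
  then obtain u0 where u0: "dt_queries u0 \<subseteq> V" "dt_depth u0 \<le> card W + m"
      "\<And>X. dt_eval_set u0 X = dt_eval_set (t (X \<inter> W)) X"
    by auto
  have "\<exists>u. dt_queries u \<subseteq> V \<and> dt_depth u \<le> card W + m \<and>
      (\<forall>X. dt_eval_set u X = dt_eval_set (t (insert i (X \<inter> W))) X)"
  proof (rule insert.IH)
    fix Z assume "Z \<subseteq> W"
    then show "dt_queries (t (insert i Z)) \<subseteq> V \<and> dt_depth (t (insert i Z)) \<le> m"
      by (intro insert.prems(2)) auto
  qed (use insert.prems in auto)
  then obtain u1 where u1: "dt_queries u1 \<subseteq> V" "dt_depth u1 \<le> card W + m"
      "\<And>X. dt_eval_set u1 X = dt_eval_set (t (insert i (X \<inter> W))) X"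
    by auto
  show ?case
    using insert u0 u1 by (intro exI[of _ "Query i u0 u1"]) auto
qed

text \<open>A member missing the union could be added to a maximal family, hence would already
  belong to it and be disjoint from itself, thus empty.\<close>

lemma exists_maximal_disjoint_family:
  assumes "finite \<S>" "{} \<notin> \<S>"
  obtains M where "M \<subseteq> \<S>" "\<And>A B. A \<in> M \<Longrightarrow> B \<in> M \<Longrightarrow> A \<noteq> B \<Longrightarrow> A \<inter> B = {}"
    and "\<And>S. S \<in> \<S> \<Longrightarrow> S \<inter> \<Union>M \<noteq> {}"
proof -
  define \<M> where "\<M> = {M. M \<subseteq> \<S> \<and> (\<forall>A\<in>M. \<forall>B\<in>M. A \<noteq> B \<longrightarrow> A \<inter> B = {})}"
  have "finite \<M>" using assms(1) unfolding \<M>_def by simp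
  moreover have "{} \<in> \<M>" unfolding \<M>_def by simp
  ultimately obtain M where M: "M \<in> \<M>" and max: "\<And>M'. M' \<in> \<M> \<Longrightarrow> M \<subseteq> M' \<Longrightarrow> M = M'"
    using finite_has_maximal[of \<M>] by blast
  have "S \<inter> \<Union>M \<noteq> {}" if S: "S \<in> \<S>" for S
  proof
    assume e: "S \<inter> \<Union>M = {}"
    then have "insert S M \<in> \<M>" using M S unfolding \<M>_def by blast
    then have "S \<in> M" using max[of "insert S M"] by blast
    then have "S = {}" using e by auto
    then show False using assms(2) S by simp
  qed
  with M show thesis by (intro that[of M]) (auto simp: \<M>_def)
qed

text \<open>Once \<open>W\<close> is fixed to \<open>Z\<close>, a monomial \<open>S\<close> either
  vanishes or shrinks to \<open>S - W\<close>; each monomial of top degree loses at least one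
  variable.\<close>

lemma ml_degree_le_restrict_hitting:
  assumes "finite V" and deg: "\<And>S. Suc e < card S \<Longrightarrow> c S = 0"
    and q: "\<And>X. X \<subseteq> V \<Longrightarrow> q X = (\<Sum>S\<in>Pow V. c S * of_bool (S \<subseteq> X))"
    and hit: "\<And>S. S \<subseteq> V \<Longrightarrow> card S = Suc e \<Longrightarrow> c S \<noteq> 0 \<Longrightarrow> S \<inter> W \<noteq> {}"
    and Z: "Z \<subseteq> W" "W \<subseteq> V"
  shows "ml_degree_le (V - W) e (\<lambda>Y. q (Y \<union> Z))"
proof -
  have "ml_degree_le (V - W) e (\<lambda>Y. (c S * of_bool (S \<inter> W \<subseteq> Z)) * of_bool (S - W \<subseteq> Y))"
    if S: "S \<in> Pow V" for S
  proof (cases "c S = 0")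
    case True
    then show ?thesis using ml_degree_le_const[of "V - W" e 0] assms(1) by auto
  next
    case False
    have fin: "finite S" using S assms(1) finite_subset by auto
    have "card (S - W) \<le> e"
    proof (cases "card S = Suc e")
      case True
      then have "S - W \<subset> S" using hit False S by blast
      from psubset_card_mono[OF fin this] show ?thesis using True by simp
    next
      case neq: False
      then have "card S \<le> e" using deg[of S] False by linarith
      moreover have "card (S - W) \<le> card S" by (rule card_mono[OF fin]) blast
      ultimately show ?thesis by simp
    qed
    then show ?thesis using assms(1) by (intro ml_degree_le_scale ml_degree_le_monomial) auto
  qed
  then have "ml_degree_le (V - W) e
      (\<lambda>Y. \<Sum>S\<in>Pow V. (c S * of_bool (S \<inter> W \<subseteq> Z)) * of_bool (S - W \<subseteq> Y))"
    using assms(1) by (intro ml_degree_le_sum) auto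
  then show ?thesis
  proof (rule ml_degree_le_cong)
    fix Y assume Y: "Y \<subseteq> V - W"
    have "S \<subseteq> Y \<union> Z \<longleftrightarrow> S \<inter> W \<subseteq> Z \<and> S - W \<subseteq> Y" for S using Y Z by blast
    then show "q (Y \<union> Z) = (\<Sum>S\<in>Pow V. (c S * of_bool (S \<inter> W \<subseteq> Z)) * of_bool (S - W \<subseteq> Y))"
      using Y Z by (subst q) (auto intro!: sum.cong)
  qed
qed

text \<open>Restriction lowers \<open>e\<close> but keeps \<open>d\<close>, so the same bound
  \<open>K\<close> on the number of disjoint blocks holds in every round. The induction generalises
  \<open>V\<close>, \<open>p\<close>, \<open>q\<close> and \<open>F\<close>, since restriction
  changes all four.\<close>

lemma exists_dtree:
  fixes p q :: "nat set \<Rightarrow> real"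
  assumes "\<epsilon> < 1" and K: "\<And>m::nat. real m * (1 - \<epsilon>) \<le> 8 * (real d)\<^sup>2 \<Longrightarrow> m \<le> K"
    and "finite V" "ml_degree_le V d p" "ml_degree_le V e q"
    and "\<And>X. X \<subseteq> V \<Longrightarrow> F X \<Longrightarrow> 1 \<le> \<bar>p X\<bar>"
    and "\<And>X. X \<subseteq> V \<Longrightarrow> \<not> F X \<Longrightarrow> \<bar>p X\<bar> \<le> \<epsilon>"
    and "\<And>X. X \<subseteq> V \<Longrightarrow> q X \<noteq> 0 \<longleftrightarrow> \<not> F X"
  shows "\<exists>t. dt_queries t \<subseteq> V \<and> dt_depth t \<le> e * e * K \<and> (\<forall>X\<subseteq>V. dt_eval_set t X = F X)"
  using assms(3-)
proof (induction e arbitrary: V p q F)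
  case 0
  obtain c where c: "\<And>S. 0 < card S \<Longrightarrow> c S = 0" "\<And>X. X \<subseteq> V \<Longrightarrow> q X = (\<Sum>S\<in>Pow X. c S)"
    using ml_degree_leE[OF "0.prems"(3,1)] by metis
  have "q X = c {}" if X: "X \<subseteq> V" for X
  proof -
    have fin: "finite X" using X "0.prems"(1) finite_subset by auto
    have "(\<Sum>S\<in>Pow X. c S) = (\<Sum>S\<in>{{}}. c S)"
    proof (rule sum.mono_neutral_right)
      show "\<forall>S\<in>Pow X - {{}}. c S = 0"
        using c(1) fin by (auto simp: card_gt_0_iff intro: finite_subset)
    qed (use fin in auto)
    then show ?thesis using c(2)[OF X] by simp
  qed
  \<comment> \<open>Degree 0 makes \<open>q\<close> constant, and \<open>F\<close> is determined by
    where \<open>q\<close> vanishes.\<close>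
  then have const: "F X = F {}" if "X \<subseteq> V" for X
    using "0.prems"(6)[OF that] "0.prems"(6)[of "{}"] that by auto
  show ?case
  proof (intro exI[of _ "Leaf (F {})"] conjI allI impI)
    fix X assume "X \<subseteq> V"
    then show "dt_eval_set (Leaf (F {})) X = F X" by (simp only: const dt_eval_set.simps)
  qed simp_all
next
  case (Suc e)
  note fin = Suc.prems(1)
  show ?case
  proof (cases "\<exists>X\<subseteq>V. F X")
    case False
    then show ?thesis by (intro exI[of _ "Leaf False"]) auto
  next
    case True
    \<comment> \<open>Maximality of \<open>z\<close> makes up for the missing upper bound on \<open>\<bar>p\<bar>\<close>.\<close>
    define A where "A = (\<lambda>X. \<bar>p X\<bar>) ` {X. X \<subseteq> V \<and> F X}"
    have A: "finite A" "A \<noteq> {}" using fin True by (auto simp: A_def)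
    then have "Max A \<in> A" by (rule Max_in)
    then obtain z where z: "z \<subseteq> V" "F z" and pz: "\<bar>p z\<bar> = Max A" by (auto simp: A_def)
    have "\<bar>p X\<bar> \<le> \<bar>p z\<bar>" if "X \<subseteq> V" "F X" for X
      unfolding pz using A that by (intro Max_ge) (auto simp: A_def)
    moreover have "1 \<le> \<bar>p z\<bar>" using z Suc.prems(4) by auto
    \<comment> \<open>Where \<open>F\<close> fails, the value is at most
      \<open>\<epsilon> < 1\<close>, so the maximum over \<open>F\<close> is global.\<close>
    ultimately have max: "\<bar>p X\<bar> \<le> \<bar>p z\<bar>" if "X \<subseteq> V" for X
      using Suc.prems(5)[OF that] \<open>\<epsilon> < 1\<close> that by (cases "F X") auto
    obtain c where c: "\<And>S. Suc e < card S \<Longrightarrow> c S = 0" "\<And>X. X \<subseteq> V \<Longrightarrow> q X = (\<Sum>S\<in>Pow X. c S)"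
        "\<And>X. X \<subseteq> V \<Longrightarrow> q X = (\<Sum>S\<in>Pow V. c S * of_bool (S \<subseteq> X))"
      using ml_degree_leE[OF Suc.prems(3) fin] by metis
    define \<S> where "\<S> = {S. S \<subseteq> V \<and> card S = Suc e \<and> c S \<noteq> 0}"
    have "finite \<S>" "{} \<notin> \<S>" using fin by (auto simp: \<S>_def)
    then obtain M where M: "M \<subseteq> \<S>" "\<And>A B. A \<in> M \<Longrightarrow> B \<in> M \<Longrightarrow> A \<noteq> B \<Longrightarrow> A \<inter> B = {}"
       "\<And>S. S \<in> \<S> \<Longrightarrow> S \<inter> \<Union>M \<noteq> {}"
      by (rule exists_maximal_disjoint_family) blast
    have finM: "finite M" using M(1) \<open>finite \<S>\<close> finite_subset by blast
    have "\<exists>B\<subseteq>S. \<not> F ((z - B) \<union> (B - z))" if "S \<in> M" for S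
    proof -
      have S: "S \<subseteq> V" "card S = Suc e" "c S \<noteq> 0" using that M(1) by (auto simp: \<S>_def)
      obtain B where B: "B \<subseteq> S" "(\<Sum>R\<in>Pow ((z - B) \<union> (B - z)). c R) \<noteq> 0"
        using max_monomial_contains_nonvanishing_flip[where c=c and e="Suc e", OF fin c(1) S z(1)] by blast
      have "(z - B) \<union> (B - z) \<subseteq> V" using B S z by blast
      then show ?thesis using B c(2) Suc.prems(6) by metis
    qed
    then obtain B where B: "\<And>S. S \<in> M \<Longrightarrow> B S \<subseteq> S" "\<And>S. S \<in> M \<Longrightarrow> \<not> F ((z - B S) \<union> (B S - z))"
      by metis
    have BV: "B S \<subseteq> V" if "S \<in> M" for S using B(1)[OF that] M(1) that by (auto simp: \<S>_def)
    have "real (card M) * (1 - \<epsilon>) \<le> 8 * (real d)\<^sup>2"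
    proof (rule disjoint_blocks_at_maximum_le[where B=B, OF fin finM Suc.prems(2) z(1) BV])
      show "B S \<inter> B T = {}" if "S \<in> M" "T \<in> M" "S \<noteq> T" for S T
        using M(2)[OF that] B(1)[of S] B(1)[of T] that by blast
      show "\<bar>p ((z - B S) \<union> (B S - z))\<bar> \<le> \<epsilon>" if "S \<in> M" for S
        using B(2)[OF that] BV[OF that] z by (intro Suc.prems(5)) auto
    qed (use max \<open>1 \<le> \<bar>p z\<bar>\<close> in auto)
    then have "card M \<le> K" by (rule K)
    define W where "W = \<Union>M"
    have WV: "W \<subseteq> V" using M(1) by (auto simp: W_def \<S>_def)
    have finW: "finite W" using WV fin finite_subset by auto
    have "card W \<le> (\<Sum>S\<in>M. card S)" unfolding W_def by (rule card_Union_le_sum_card)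
    also have "\<dots> = card M * Suc e" using M(1) by (simp add: \<S>_def subset_iff)
    also have "\<dots> \<le> K * Suc e" using \<open>card M \<le> K\<close> by (rule mult_right_mono) simp
    finally have cardW: "card W \<le> K * Suc e" .
    \<comment> \<open>Since \<open>W\<close> meets every top-degree monomial, the induction
      hypothesis applies to the subcube given by any answer \<open>Z\<close>.\<close>
    have "\<exists>t. dt_queries t \<subseteq> V - W \<and> dt_depth t \<le> e * e * K \<and>
        (\<forall>Y\<subseteq>V - W. dt_eval_set t Y = F (Y \<union> Z))" if Z: "Z \<subseteq> W" for Z
    proof (rule Suc.IH)
      have sub: "Y \<union> Z \<subseteq> V" if "Y \<subseteq> V - W" for Y using that Z WV by blast
      show "finite (V - W)" using fin by simp
      show "ml_degree_le (V - W) d (\<lambda>Y. p (Y \<union> Z))"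
      proof (rule ml_degree_le_compose[where g=p and h="\<lambda>Y. Y \<union> Z", OF _ fin Suc.prems(2) sub])
        fix s
        show "ml_degree_le (V - W) 1 (\<lambda>Y. of_bool (s \<in> Y \<union> Z))"
          using ml_degree_le_literal(1)[of "V - W" s] ml_degree_le_const[of "V - W" 1 1] fin
          by (cases "s \<in> Z") auto
      qed (use fin in auto)
      show "ml_degree_le (V - W) e (\<lambda>Y. q (Y \<union> Z))"
      proof (rule ml_degree_le_restrict_hitting[where c=c and e=e and q=q, OF fin c(1) c(3) _ Z WV])
        show "S \<inter> W \<noteq> {}" if "S \<subseteq> V" "card S = Suc e" "c S \<noteq> 0" for S
          using M(3)[of S] that by (simp add: \<S>_def W_def)
      qed
    next
      fix Y assume "Y \<subseteq> V - W"
      then have Y: "Y \<union> Z \<subseteq> V" using Z WV by blast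
      show "F (Y \<union> Z) \<Longrightarrow> 1 \<le> \<bar>p (Y \<union> Z)\<bar>" by (rule Suc.prems(4)[OF Y])
      show "\<not> F (Y \<union> Z) \<Longrightarrow> \<bar>p (Y \<union> Z)\<bar> \<le> \<epsilon>" by (rule Suc.prems(5)[OF Y])
      show "q (Y \<union> Z) \<noteq> 0 \<longleftrightarrow> \<not> F (Y \<union> Z)" by (rule Suc.prems(6)[OF Y])
    qed
    then obtain t where t: "\<And>Z. Z \<subseteq> W \<Longrightarrow> dt_queries (t Z) \<subseteq> V - W"
       "\<And>Z. Z \<subseteq> W \<Longrightarrow> dt_depth (t Z) \<le> e * e * K"
       "\<And>Z Y. Z \<subseteq> W \<Longrightarrow> Y \<subseteq> V - W \<Longrightarrow> dt_eval_set (t Z) Y = F (Y \<union> Z)"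
      by metis
    have "\<exists>u. dt_queries u \<subseteq> V \<and> dt_depth u \<le> card W + e * e * K \<and>
             (\<forall>X. dt_eval_set u X = dt_eval_set (t (X \<inter> W)) X)"
      using t(1,2) by (intro dtree_query_all finW WV) blast
    then obtain u where u: "dt_queries u \<subseteq> V" "dt_depth u \<le> card W + e * e * K"
        "\<And>X. dt_eval_set u X = dt_eval_set (t (X \<inter> W)) X"
      by blast
    have "dt_eval_set u X = F X" if X: "X \<subseteq> V" for X
    proof -
      \<comment> \<open>The continuation queries only variables outside \<open>W\<close>.\<close>
      have "dt_eval_set (t (X \<inter> W)) X = dt_eval_set (t (X \<inter> W)) (X - W)"
        using t(1)[of "X \<inter> W"] by (intro dt_eval_set_cong) auto
      also have "\<dots> = F ((X - W) \<union> (X \<inter> W))" using X by (intro t(3)) auto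
      also have "(X - W) \<union> (X \<inter> W) = X" by blast
      finally show ?thesis using u(3) by simp
    qed
    moreover have "card W + e * e * K \<le> Suc e * Suc e * K" using cardW by (simp add: algebra_simps)
    ultimately show ?thesis using u(1,2) by (meson order_trans)
  qed
qed

subsection \<open>Polynomials on the cube\<close>

definition cube_point :: "nat \<Rightarrow> nat set \<Rightarrow> bool list" where
  "cube_point n X = map (\<lambda>i. i \<in> X) [0..<n]"

lemma cube_point_in_cube: "cube_point n X \<in> cube n"
  by (simp add: cube_point_def cube_def)

lemma cube_point_support: "x \<in> cube n \<Longrightarrow> cube_point n {i. i < n \<and> x ! i} = x"
  by (auto simp: cube_point_def cube_def intro: nth_equalityI)

lemma monom_deg_le_total_deg: "m \<in> Poly_Mapping.keys p \<Longrightarrow> monom_deg m \<le> total_deg p"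
  unfolding total_deg_def by (intro Max_ge) auto

lemma card_keys_le_monom_deg: "card (Poly_Mapping.keys m) \<le> monom_deg m"
proof -
  have "card (Poly_Mapping.keys m) = (\<Sum>i\<in>Poly_Mapping.keys m. 1)" by simp
  also have "\<dots> \<le> monom_deg m"
    unfolding monom_deg_def by (intro sum_mono) (simp add: in_keys_iff Suc_le_eq)
  finally show ?thesis .
qed

lemma prod_of_bool_power_keys:
  "(\<Prod>i\<in>Poly_Mapping.keys m. of_bool (b i) ^ Poly_Mapping.lookup m i) =
     (of_bool (\<forall>i\<in>Poly_Mapping.keys m. b i) :: real)"
proof (cases "\<forall>i\<in>Poly_Mapping.keys m. b i")
  case False
  then show ?thesis by (auto intro!: prod_zero simp: in_keys_iff)
qed simp

text \<open>On 0/1 points powers collapse: a monomial acts through its support, which has at most as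
  many elements as its degree.\<close>

lemma ml_degree_le_cube_eval:
  assumes "poly_vars p \<subseteq> {..<n}"
  shows "ml_degree_le {..<n} (total_deg p) (\<lambda>X. cube_eval p (cube_point n X))"
proof -
  have "ml_degree_le {..<n} (total_deg p)
      (\<lambda>X. \<Sum>m\<in>Poly_Mapping.keys p. Poly_Mapping.lookup p m * of_bool (Poly_Mapping.keys m \<subseteq> X))"
    using order_trans[OF card_keys_le_monom_deg monom_deg_le_total_deg]
    by (intro ml_degree_le_sum ml_degree_le_scale ml_degree_le_monomial) auto
  then show ?thesis
  proof (rule ml_degree_le_cong)
    fix X
    have "(\<forall>i\<in>Poly_Mapping.keys m. cube_point n X ! i) \<longleftrightarrow> Poly_Mapping.keys m \<subseteq> X"
      if "m \<in> Poly_Mapping.keys p" for m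
    proof -
      have "i < n" if "i \<in> Poly_Mapping.keys m" for i
        using assms that \<open>m \<in> Poly_Mapping.keys p\<close> unfolding poly_vars_def by auto
      then show ?thesis by (auto simp: cube_point_def)
    qed
    then show "cube_eval p (cube_point n X) =
       (\<Sum>m\<in>Poly_Mapping.keys p. Poly_Mapping.lookup p m * of_bool (Poly_Mapping.keys m \<subseteq> X))"
      unfolding cube_eval_def poly_eval_def prod_of_bool_power_keys by (intro sum.cong) auto
  qed
qed

section \<open>Existence of witness polynomials and the resulting bound\<close>

lemma poly_eval_superset:
  assumes "finite A" "Poly_Mapping.keys p \<subseteq> A"
  shows "poly_eval p v =
    (\<Sum>m\<in>A. Poly_Mapping.lookup p m * (\<Prod>i\<in>Poly_Mapping.keys m. v i ^ Poly_Mapping.lookup m i))"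
  unfolding poly_eval_def
  by (intro sum.mono_neutral_left assms) (auto simp: in_keys_iff)

lemma poly_eval_add: "poly_eval (p + q) v = poly_eval p v + poly_eval q v"
proof -
  let ?A = "Poly_Mapping.keys p \<union> Poly_Mapping.keys q"
  have "poly_eval r v = (\<Sum>m\<in>?A. Poly_Mapping.lookup r m * (\<Prod>i\<in>Poly_Mapping.keys m. v i ^ Poly_Mapping.lookup m i))"
    if "r \<in> {p, q, p + q}" for r
    using that keys_add[of p q] by (intro poly_eval_superset) auto
  then show ?thesis by (simp add: lookup_add distrib_right sum.distrib)
qed

lemma poly_eval_sum: "poly_eval (\<Sum>i\<in>I. p i) v = (\<Sum>i\<in>I. poly_eval (p i) v)"
proof (induction I rule: infinite_finite_induct)
  case (insert i I)
  then show ?case by (simp add: poly_eval_add)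
qed (simp_all add: poly_eval_def)

text \<open>The exact multilinear representation of \<open>f\<close> is a witness for every
  nonnegative \<open>\<epsilon>\<close>; hence the minimum in \<open>ndeg_eps\<close> is
  attained.\<close>

lemma exists_ndeg_witness:
  assumes "0 \<le> \<epsilon>"
  shows "\<exists>p. ndeg_witness n \<epsilon> f p"
proof -
  obtain c where c: "\<And>X. X \<subseteq> {..<n} \<Longrightarrow> of_bool (f (cube_point n X)) = (\<Sum>S\<in>Pow {..<n}. c S * of_bool (S \<subseteq> X) :: real)"
    using ml_degree_leE[OF ml_degree_le_card[of "{..<n}" "\<lambda>X. of_bool (f (cube_point n X))"]]
    by (metis finite_lessThan)
  define mon :: "nat set \<Rightarrow> nat \<Rightarrow>\<^sub>0 nat" where "mon S = (\<Sum>i\<in>S. Poly_Mapping.single i 1)" for S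
  have look: "Poly_Mapping.lookup (mon S) i = of_bool (i \<in> S)" if "finite S" for S i
    using that by (simp add: mon_def lookup_sum lookup_single when_def of_bool_def)
  have keys: "Poly_Mapping.keys (mon S) = S" if "finite S" for S
    using look[OF that] by (auto simp: in_keys_iff)
  define p where "p = (\<Sum>S\<in>Pow {..<n}. Poly_Mapping.single (mon S) (c S))"
  have "cube_eval p x = of_bool (f x)" if x: "x \<in> cube n" for x
  proof -
    define X where "X = {i. i < n \<and> x ! i}"
    have "poly_eval (Poly_Mapping.single (mon S) (c S)) (\<lambda>i. of_bool (x ! i)) = c S * of_bool (S \<subseteq> X)"
      if "S \<in> Pow {..<n}" for S
    proof -
      have fin: "finite S" using that finite_subset by auto
      have "poly_eval (Poly_Mapping.single (mon S) (c S)) (\<lambda>i. of_bool (x ! i)) =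
          (\<Sum>m\<in>{mon S}. Poly_Mapping.lookup (Poly_Mapping.single (mon S) (c S)) m *
            (\<Prod>i\<in>Poly_Mapping.keys m. of_bool (x ! i) ^ Poly_Mapping.lookup m i))"
        by (rule poly_eval_superset) auto
      also have "\<dots> = c S * of_bool (\<forall>i\<in>S. x ! i)"
        unfolding prod_of_bool_power_keys by (simp add: keys[OF fin])
      also have "(\<forall>i\<in>S. x ! i) \<longleftrightarrow> S \<subseteq> X" using that by (auto simp: X_def)
      finally show ?thesis .
    qed
    then have "cube_eval p x = (\<Sum>S\<in>Pow {..<n}. c S * of_bool (S \<subseteq> X))"
      unfolding cube_eval_def p_def poly_eval_sum by (intro sum.cong) auto
    also have "\<dots> = of_bool (f (cube_point n X))" by (subst c) (auto simp: X_def)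
    also have "cube_point n X = x" unfolding X_def by (rule cube_point_support[OF x])
    finally show ?thesis .
  qed
  moreover have "poly_vars p \<subseteq> {..<n}"
  proof -
    have "Poly_Mapping.keys p \<subseteq> mon ` Pow {..<n}"
      unfolding p_def by (rule order_trans[OF keys_sum]) (auto split: if_splits)
    moreover have "Poly_Mapping.keys (mon S) \<subseteq> {..<n}" if "S \<in> Pow {..<n}" for S
      using that keys[of S] finite_subset[of S "{..<n}"] by simp
    ultimately show ?thesis unfolding poly_vars_def by blast
  qed
  ultimately have "ndeg_witness n \<epsilon> f p" using assms by (simp add: ndeg_witness_def)
  then show ?thesis by blast
qed

lemma ndeg_eps_attained:
  assumes "0 \<le> \<epsilon>"
  obtains p where "ndeg_witness n \<epsilon> f p" "total_deg p = ndeg_eps n \<epsilon> f"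
proof -
  have "\<exists>d p. ndeg_witness n \<epsilon> f p \<and> total_deg p = d" using exists_ndeg_witness[OF assms] by blast
  from LeastI_ex[OF this] show thesis using that unfolding ndeg_eps_def by blast
qed

lemma det_query_le_ndeg:
  assumes "0 \<le> \<epsilon>" "\<epsilon> < 1"
  shows "real (det_query n f) \<le> 8 / (1 - \<epsilon>) * (real (ndeg_eps n \<epsilon> f))\<^sup>2 * (real (ndeg n (bneg f)))\<^sup>2"
proof -
  define d where "d = ndeg_eps n \<epsilon> f"
  define e where "e = ndeg n (bneg f)"
  obtain p where p: "ndeg_witness n \<epsilon> f p" "total_deg p = d"
    unfolding d_def by (rule ndeg_eps_attained[OF assms(1)])
  obtain q where q: "ndeg_witness n 0 (bneg f) q" "total_deg q = e"
    unfolding e_def ndeg_def by (rule ndeg_eps_attained[OF order_refl])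
  \<comment> \<open>The bound applies to block counts, which are integers, so rounding down is safe
    and leaves the constant \<open>8 / (1 - \<epsilon>)\<close> intact.\<close>
  define K where "K = nat \<lfloor>8 * (real d)\<^sup>2 / (1 - \<epsilon>)\<rfloor>"
  have K: "m \<le> K" if "real m * (1 - \<epsilon>) \<le> 8 * (real d)\<^sup>2" for m
  proof -
    have "real m \<le> 8 * (real d)\<^sup>2 / (1 - \<epsilon>)" using that assms(2) by (simp add: le_divide_eq)
    then show ?thesis unfolding K_def by linarith
  qed
  have "\<exists>t. dt_queries t \<subseteq> {..<n} \<and> dt_depth t \<le> e * e * K \<and>
      (\<forall>X\<subseteq>{..<n}. dt_eval_set t X = f (cube_point n X))"
  proof (rule exists_dtree[where d=d and K=K, OF assms(2) K])
    show "ml_degree_le {..<n} d (\<lambda>X. cube_eval p (cube_point n X))"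
      using p ml_degree_le_cube_eval unfolding ndeg_witness_def by blast
    show "ml_degree_le {..<n} e (\<lambda>X. cube_eval q (cube_point n X))"
      using q ml_degree_le_cube_eval unfolding ndeg_witness_def by blast
    fix X
    show "f (cube_point n X) \<Longrightarrow> 1 \<le> \<bar>cube_eval p (cube_point n X)\<bar>"
      "\<not> f (cube_point n X) \<Longrightarrow> \<bar>cube_eval p (cube_point n X)\<bar> \<le> \<epsilon>"
      using p(1) cube_point_in_cube unfolding ndeg_witness_def by blast+
    show "cube_eval q (cube_point n X) \<noteq> 0 \<longleftrightarrow> \<not> f (cube_point n X)"
      using q(1) cube_point_in_cube[of n X] unfolding ndeg_witness_def bneg_def by force
  qed auto
  then obtain t where t: "dt_queries t \<subseteq> {..<n}" "dt_depth t \<le> e * e * K"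
      "\<And>X. X \<subseteq> {..<n} \<Longrightarrow> dt_eval_set t X = f (cube_point n X)"
    by blast
  have "dt_eval t x = f x" if "x \<in> cube n" for x
    unfolding dt_eval_eq_dt_eval_set[OF t(1)] by (subst t(3)) (auto simp: cube_point_support[OF that])
  then have "dt_computes n t f" using t(1) by (simp add: dt_computes_def)
  then have "det_query n f \<le> dt_depth t" unfolding det_query_def by (intro Least_le) blast
  then have "real (det_query n f) \<le> real (e * e * K)" using t(2) by (meson of_nat_mono order_trans)
  also have "\<dots> = (real e)\<^sup>2 * real K" by (simp add: power2_eq_square)
  also have "\<dots> \<le> (real e)\<^sup>2 * (8 * (real d)\<^sup>2 / (1 - \<epsilon>))"
  proof (rule mult_left_mono)
    have "0 \<le> 8 * (real d)\<^sup>2 / (1 - \<epsilon>)" using assms(2) by simp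
    then show "real K \<le> 8 * (real d)\<^sup>2 / (1 - \<epsilon>)" unfolding K_def by linarith
  qed simp
  finally show ?thesis unfolding d_def e_def by (simp add: mult_ac)
qed

section \<open>Symmetry under negation\<close>

primrec dt_neg :: "dtree \<Rightarrow> dtree" where
  "dt_neg (Leaf b) = Leaf (\<not> b)"
| "dt_neg (Query i t0 t1) = Query i (dt_neg t0) (dt_neg t1)"

lemma dt_neg_simps [simp]:
  "dt_eval (dt_neg t) x = (\<not> dt_eval t x)" "dt_depth (dt_neg t) = dt_depth t"
  "dt_queries (dt_neg t) = dt_queries t"
  by (induction t) auto

lemma bneg_bneg [simp]: "bneg (bneg f) = f"
  by (simp add: bneg_def)

lemma det_query_bneg: "det_query n (bneg f) = det_query n f"
proof -
  have *: "\<exists>t'. dt_computes n t' (bneg g) \<and> dt_depth t' = dt_depth t" if "dt_computes n t g" for t g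
    using that by (intro exI[of _ "dt_neg t"]) (simp add: dt_computes_def bneg_def)
  have "(\<exists>t. dt_computes n t (bneg f) \<and> dt_depth t = d) \<longleftrightarrow> (\<exists>t. dt_computes n t f \<and> dt_depth t = d)" for d
    using *[of _ f] *[of _ "bneg f"] by auto
  then show ?thesis by (simp add: det_query_def)
qed

theorem theorem4p6:
  fixes \<epsilon> :: real
  assumes "0 \<le> \<epsilon>" and "\<epsilon> < 1"
  shows "\<exists>C::real. \<forall>(n::nat) (f :: bool list \<Rightarrow> bool).
           real (det_query n f) \<le> C * real (ndeg_eps n \<epsilon> f) ^ 2 * real (ndeg n (bneg f)) ^ 2 \<and>
           real (det_query n f) \<le> C * real (ndeg n f) ^ 2 * real (ndeg_eps n \<epsilon> (bneg f)) ^ 2"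
proof (intro exI allI conjI)
  fix n :: nat and f :: "bool list \<Rightarrow> bool"
  show "real (det_query n f) \<le>
      8 / (1 - \<epsilon>) * real (ndeg_eps n \<epsilon> f) ^ 2 * real (ndeg n (bneg f)) ^ 2"
    by (rule det_query_le_ndeg[OF assms])
  show "real (det_query n f) \<le>
      8 / (1 - \<epsilon>) * real (ndeg n f) ^ 2 * real (ndeg_eps n \<epsilon> (bneg f)) ^ 2"
    \<comment> \<open>The second bound is the first one for \<open>bneg f\<close>, as double
      negation cancels and both functions have the same query depth.\<close>
    using det_query_le_ndeg[OF assms, of n "bneg f"] by (simp add: det_query_bneg mult_ac)
qed

end
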